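(* Let $G=(V,E)$ be any weakly connected acyclic directed graph (DAG) with $n\ge1$ nodes, and let $\mathcal I:V\to[n]$ be any indexing produced by Algorithm D (described in the context) on input $G$, for any choices made in breaking ties. Identify each node with its index under $\mathcal I$, so that for $v\in[n]$, $\mathcal S(v)\subseteq[n]$ denotes the set of indexes of the successors of the node with index $v$. Then $$LO(\mathcal S(v))\le LO(\mathcal S(v+1))\qquad\text{for all } v\in[n-1].$$
   Context: Graphs are finite, without self-loops or multiple edges. $[m]=\{0,1,\dots,m-1\}$. A directed graph is weakly connected if the undirected graph obtained by forgetting edge directions is connected. The successor set of a node $v\in V$ of a DAG is $\mathcal S(v)=\{u\in V\setminus\{v\}: v\text{ can reach }u\text{ by a directed path}\}$. Lexicographical order $LO$: for integers $L,M$, $Seq(L,M)$ is the set of non-decreasing integer sequences $(a_1,\dots,a_L)$ with $0\le a_1\le\dots\le a_L\le M$. For $a,b\in Seq(L,M)$, $LO(a)<LO(b)$ means that there is $l\in\{1,\dots,L\}$ with $a_i=b_i$ for $1\le i<l$ and $a_l<b_l$; $LO(a)=LO(b)$ means $a=b$; $LO(a)\le LO(b)$ means one of these. For a multiset $S$ of at most $L$ integers in $[0,M-1]$, sort its elements in non-decreasing order and append copies of $M$ until the length is $L$; $LO(S)$ denotes $LO$ of the resulting sequence. Here $L=n-1$ and $M=n$. Algorithm D. Input: a DAG $G=(V,E)$ with $|V|=n$ and successor sets $\mathcal S(v)\subseteq V$. Set $V_1^{n-1}=\emptyset$. For $s=n-1,n-2,\dots,0$ in turn: (i) $V_2^s=V\setminus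 V_1^s$ (the unindexed nodes); (ii) temporary indexes: $\mathcal I^s(v)=\mathcal I(v)$ for $v\in V_1^s$ and $\mathcal I^s(v)=s$ for $v\in V_2^s$; (iii) for $v\in V_2^s$, $\mathcal S_t^s(v)$ is the multiset $\{\mathcal I^s(u):u\in\mathcal S(v)\}$; (iv) choose $v^s\in V_2^s$ maximizing $LO(\mathcal S_t^s(v))$ over $v\in V_2^s$ (ties broken arbitrarily), set $\mathcal I(v^s)=s$ and $V_1^{s-1}=V_1^s\cup\{v^s\}$. Output: the bijection $\mathcal I:V\to[n]$. *)

theory Defs
  imports "Graph_Theory.Digraph_Component" "HOL-Library.Multiset"
begin

text \<open>
  The library's \<open>cycle\<close> is a nonempty directed closed walk without repeated vertices; a pair of
  antiparallel arcs forms a cycle, so a \<open>dag\<close> is an orientation of a simple undirected graph.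
\<close>
locale dag = digraph +
  assumes acyclic: "\<not> cycle p"

definition successors :: "('a, 'b) pre_digraph \<Rightarrow> 'a \<Rightarrow> 'a set" where
  "successors G v = {u \<in> verts G - {v}. v \<rightarrow>\<^sup>*\<^bsub>G\<^esub> u}"

definition Seq :: "nat \<Rightarrow> nat \<Rightarrow> nat list set" where
  "Seq L M = {a. length a = L \<and> sorted a \<and> (\<forall>x \<in> set a. x \<le> M)}"

text \<open>
  \<open>lex\<close> only relates lists of equal length: the two lists agree up to some position,
  at which the first one has the smaller entry.
\<close>
definition LO_less :: "nat list \<Rightarrow> nat list \<Rightarrow> bool" where
  "LO_less a b \<longleftrightarrow> (a, b) \<in> lex less_than"

definition LO_le :: "nat list \<Rightarrow> nat list \<Rightarrow> bool" where
  "LO_le a b \<longleftrightarrow> LO_less a b \<or> a = b"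

definition LO_seq :: "nat \<Rightarrow> nat \<Rightarrow> nat multiset \<Rightarrow> nat list" where
  "LO_seq L M S = sorted_list_of_multiset S @ replicate (L - size S) M"

lemma LO_seq_in_Seq:
  assumes "size S \<le> L" "\<And>x. x \<in># S \<Longrightarrow> x < M"
  shows "LO_seq L M S \<in> Seq L M"
proof -
  have len: "length (sorted_list_of_multiset S) = size S"
    by (metis mset_sorted_list_of_multiset size_mset)
  have "sorted (sorted_list_of_multiset S)" by simp
  then show ?thesis
    using assms len
    by (auto simp: LO_seq_def Seq_def sorted_append less_imp_le)
qed

definition temp_succ_indexes ::
  "('a, 'b) pre_digraph \<Rightarrow> nat \<Rightarrow> 'a set \<Rightarrow> ('a \<Rightarrow> nat) \<Rightarrow> 'a \<Rightarrow> nat multiset" where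
  "temp_succ_indexes G s V1 I v =
     {#if u \<in> V1 then I u else s. u \<in># mset_set (successors G v)#}"

text \<open>
  \<open>algD_state G r V1 I\<close>: the algorithm can reach a state in which \<open>r\<close> nodes are still unindexed,
  \<open>V1\<close> is the set of indexed nodes, and \<open>I\<close> restricted to \<open>V1\<close> is the indexing so far (values of
  \<open>I\<close> outside \<open>V1\<close> are uninitialised and never read). The round that assigns the index \<open>s\<close> leads
  from \<open>r = Suc s\<close> to \<open>r = s\<close>; counting unindexed nodes avoids the index \<open>-1\<close> after round \<open>0\<close>.
\<close>
inductive algD_state ::
  "('a, 'b) pre_digraph \<Rightarrow> nat \<Rightarrow> 'a set \<Rightarrow> ('a \<Rightarrow> nat) \<Rightarrow> bool"
  for G :: "('a, 'b) pre_digraph" where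
  init: "algD_state G (card (verts G)) {} I"
| round: "algD_state G s (insert v V1) (I(v := s))"
    if "algD_state G (Suc s) V1 I"
      and "n = card (verts G)"
      and "v \<in> verts G - V1"
      and "\<And>w. w \<in> verts G - V1 \<Longrightarrow>
             LO_le (LO_seq (n - 1) n (temp_succ_indexes G s V1 I w))
                   (LO_seq (n - 1) n (temp_succ_indexes G s V1 I v))"

definition algD_output :: "('a, 'b) pre_digraph \<Rightarrow> ('a \<Rightarrow> nat) \<Rightarrow> bool" where
  "algD_output G I \<longleftrightarrow> (\<exists>V1. algD_state G 0 V1 I)"

lemma algD_state_bij:
  assumes "algD_state G r V1 I" "finite (verts G)"
  shows "V1 \<subseteq> verts G \<and> r \<le> card (verts G) \<and> bij_betw I V1 {r..<card (verts G)}"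
  using assms
proof (induction rule: algD_state.induct)
  case (init I)
  then show ?case by (simp add: bij_betw_def)
next
  case (round s V1 I n v)
  have "bij_betw (I(v := s)) V1 {Suc s..<card (verts G)}"
    using round by (subst bij_betw_cong[of _ _ I]) auto
  then have "bij_betw (I(v := s)) (V1 \<union> {v}) ({Suc s..<card (verts G)} \<union> {(I(v := s)) v})"
    using round by (intro notIn_Un_bij_betw) auto
  moreover have "{Suc s..<card (verts G)} \<union> {(I(v := s)) v} = {s..<card (verts G)}"
    using round by auto
  ultimately show ?case using round by (simp del: fun_upd_apply)
qed

lemma algD_output_bij:
  assumes "algD_output G I" "finite (verts G)"
  shows "bij_betw I (verts G) {..<card (verts G)}"
proof -
  obtain V1 where V1: "V1 \<subseteq> verts G" "bij_betw I V1 {0..<card (verts G)}"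
    using assms algD_state_bij unfolding algD_output_def by blast
  then have "card V1 = card (verts G)"
    using bij_betw_same_card by fastforce
  then have "V1 = verts G"
    using V1 assms card_subset_eq by blast
  then show ?thesis using V1 by (simp add: atLeast0LessThan)
qed

text \<open>The successor set of the node with index \<open>v\<close>, as a set of indexes.\<close>
definition succ_indexes :: "('a, 'b) pre_digraph \<Rightarrow> ('a \<Rightarrow> nat) \<Rightarrow> nat \<Rightarrow> nat set" where
  "succ_indexes G I v = I ` successors G (inv_into (verts G) I v)"

end

theory Submission
  imports Defs
begin

text \<open>
  Every round picks a node all of whose successors are already indexed. Some unindexed node has
  this property because the graph is acyclic; all entries of its sequence exceed the current index
  \<open>s\<close>, whereas the sequence of a node with an unindexed successor begins with \<open>s\<close> and is therefore
  smaller (\<open>greedy_choice_successors_indexed\<close>). So all successors of a node have larger indexes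
  than the node itself.

  Now compare the nodes \<open>w\<close> and \<open>v\<close> of indexes \<open>s\<close> and \<open>s + 1\<close>. When \<open>v\<close> was picked, \<open>w\<close> was a
  competitor. Its successors have final indexes at least \<open>s + 1\<close>, so the only one that could still
  be unindexed is \<open>v\<close> itself, and the temporary index of \<open>v\<close> in that round is \<open>s + 1\<close>, its final
  index. The temporary sequence of \<open>w\<close> thus agrees with its final one, and so does that of \<open>v\<close>; the
  maximality of \<open>v\<close> in its round is the claimed inequality. The predicate \<open>greedy_indexing\<close> states
  this comparison in terms of final indexes alone, which makes it an invariant of the algorithm.
\<close>

section \<open>Successor sets in acyclic digraphs\<close>

lemma (in dag) reachable_antisym:
  assumes "u \<rightarrow>\<^sup>*\<^bsub>G\<^esub> v" "v \<rightarrow>\<^sup>*\<^bsub>G\<^esub> u"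
  shows "u = v"
proof (rule ccontr)
  assume "u \<noteq> v"
  obtain p q where p: "awalk u p v" and q: "awalk v q u"
    using assms by (auto simp: reachable_awalk)
  have "p \<noteq> []" using p \<open>u \<noteq> v\<close> by (auto simp: awalk_Nil_iff)
  moreover have "awalk u (p @ q) u" using p q by (rule awalk_appendI)
  ultimately have "closed_w (p @ q)" by (auto simp: closed_w_def)
  then show False using closed_w_imp_cycle acyclic by blast
qed

lemma (in dag) successors_strict_subset:
  assumes "u \<in> successors G v"
  shows "successors G u \<subset> successors G v"
proof
  show "successors G u \<subseteq> successors G v"
  proof
    fix x assume x: "x \<in> successors G u"
    have vu: "v \<rightarrow>\<^sup>* u" "u \<noteq> v" and ux: "u \<rightarrow>\<^sup>* x" and "x \<in> verts G"
      using assms x unfolding successors_def by simp_all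
    have "v \<rightarrow>\<^sup>* x" using vu(1) ux by (rule reachable_trans)
    moreover have "x \<noteq> v" using reachable_antisym[OF vu(1)] ux vu(2) by blast
    ultimately show "x \<in> successors G v" using \<open>x \<in> verts G\<close> by (simp add: successors_def)
  qed
  have "u \<notin> successors G u" by (simp add: successors_def)
  then show "successors G u \<noteq> successors G v" using assms by metis
qed

lemma successors_subset: "successors G v \<subseteq> verts G - {v}"
  by (auto simp: successors_def)

lemma (in dag) finite_successors: "finite (successors G v)"
  using finite_subset[OF successors_subset[of G v]] finite_verts by simp

lemma (in dag) card_successors_le: "v \<in> verts G \<Longrightarrow> card (successors G v) \<le> card (verts G) - 1"
  using card_mono[OF _ successors_subset[of G v]] finite_verts by simp

text \<open>
  A node of \<open>A\<close> with as few successors as possible will do: a successor of it in \<open>A\<close> would have a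
  strictly smaller successor set.
\<close>
lemma (in dag) exists_relative_sink:
  assumes "A \<noteq> {}"
  shows "\<exists>w\<in>A. successors G w \<inter> A = {}"
proof -
  obtain w where w: "w \<in> A" "\<And>u. u \<in> A \<Longrightarrow> card (successors G w) \<le> card (successors G u)"
    using assms ex_has_least_nat[of "\<lambda>w. w \<in> A" _ "\<lambda>w. card (successors G w)"] by blast
  have "u \<notin> A" if "u \<in> successors G w" for u
    using w(2)[of u] psubset_card_mono[OF finite_successors successors_strict_subset[OF that]]
    by auto
  with w(1) show ?thesis by blast
qed

section \<open>Comparison of index sequences\<close>

lemma LO_le_bounded_below:
  assumes "LO_le a b" "sorted b" "s \<in> set b"
  shows "\<exists>x\<in>set a. x \<le> s"
proof (cases b)
  case Nil
  then show ?thesis using assms by simp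
next
  case b: (Cons x xs)
  have "x \<le> s" using assms b by auto
  moreover obtain y ys where a: "a = y # ys"
    using assms(1) b by (cases a) (auto simp: LO_le_def LO_less_def)
  moreover have "y \<le> x" using assms(1) a b by (auto simp: LO_le_def LO_less_def)
  ultimately show ?thesis by auto
qed

lemma set_LO_seq:
  "set (LO_seq L M S) = set_mset S \<union> (if size S < L then {M} else {})"
  by (auto simp: LO_seq_def)

section \<open>The greedy choice\<close>

lemma (in dag) temp_succ_indexes_in_Seq:
  assumes "w \<in> verts G" "s < card (verts G)" "\<And>u. u \<in> V1 \<Longrightarrow> I u < card (verts G)"
  shows "LO_seq (card (verts G) - 1) (card (verts G)) (temp_succ_indexes G s V1 I w)
         \<in> Seq (card (verts G) - 1) (card (verts G))"
  using assms card_successors_le[OF assms(1)]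
  by (intro LO_seq_in_Seq) (auto simp: temp_succ_indexes_def)

text \<open>
  A node \<open>v\<close> with an unindexed successor loses to a sink \<open>w\<close> of the unindexed part: the entry \<open>s\<close>
  in the sequence of \<open>v\<close> lies below every entry in the sequence of \<open>w\<close>.
\<close>
lemma (in dag) greedy_choice_successors_indexed:
  assumes v: "v \<in> verts G - V1"
    and s: "s < card (verts G)"
    and I: "\<And>u. u \<in> V1 \<Longrightarrow> s < I u \<and> I u < card (verts G)"
    and max: "\<And>w. w \<in> verts G - V1 \<Longrightarrow>
      LO_le (LO_seq (card (verts G) - 1) (card (verts G)) (temp_succ_indexes G s V1 I w))
            (LO_seq (card (verts G) - 1) (card (verts G)) (temp_succ_indexes G s V1 I v))"
  shows "successors G v \<subseteq> V1"
proof (rule ccontr)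
  let ?key = "\<lambda>w. LO_seq (card (verts G) - 1) (card (verts G)) (temp_succ_indexes G s V1 I w)"
  assume "\<not> successors G v \<subseteq> V1"
  then have "s \<in># temp_succ_indexes G s V1 I v"
    by (auto simp: temp_succ_indexes_def finite_successors image_iff)
  then have s_in: "s \<in> set (?key v)" by (simp add: set_LO_seq)
  have sorted: "sorted (?key v)"
    using temp_succ_indexes_in_Seq[of v s V1 I] v s I by (auto simp: Seq_def)
  obtain w where w: "w \<in> verts G - V1" "successors G w \<inter> (verts G - V1) = {}"
    using exists_relative_sink[of "verts G - V1"] v by blast
  then have "successors G w \<subseteq> V1" using successors_subset[of G w] by blast
  \<comment> \<open>the padding value also exceeds \<open>s\<close>\<close>
  then have "\<forall>x\<in>set (?key w). s < x"
    using s I by (auto simp: set_LO_seq temp_succ_indexes_def finite_successors)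
  then show False using LO_le_bounded_below[OF max[OF w(1)] sorted s_in] by auto
qed

text \<open>
  Here \<open>J\<close> stands for the indexing after the round. Typically the only unindexed successor of \<open>w\<close>,
  if there is one, is the node picked in this very round, which receives the index \<open>s\<close>.
\<close>
lemma temp_succ_indexes_final:
  assumes "\<And>u. u \<in> successors G w \<Longrightarrow> u \<notin> V1 \<Longrightarrow> J u = s"
    and "\<And>u. u \<in> V1 \<Longrightarrow> J u = I u"
  shows "temp_succ_indexes G s V1 I w = image_mset J (mset_set (successors G w))"
  unfolding temp_succ_indexes_def
proof (rule image_mset_cong)
  fix u assume "u \<in># mset_set (successors G w)"
  then have "u \<in> successors G w" by (cases "finite (successors G w)") auto
  then show "(if u \<in> V1 then I u else s) = J u" using assms by auto
qed

text \<open>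
  A node without an index counts as having a smaller one than \<open>v\<close>, since it will be picked later.
  The condition on the successors of \<open>w\<close> is what makes the temporary sequence of \<open>w\<close> in the round
  of \<open>v\<close> equal to its final one.
\<close>
definition greedy_indexing :: "('a, 'b) pre_digraph \<Rightarrow> 'a set \<Rightarrow> ('a \<Rightarrow> nat) \<Rightarrow> bool" where
  "greedy_indexing G V1 I \<longleftrightarrow>
    (\<forall>v\<in>V1. \<forall>u\<in>successors G v. u \<in> V1 \<and> I v < I u) \<and>
    (\<forall>v\<in>V1. \<forall>w\<in>verts G.
       (w \<in> V1 \<longrightarrow> I w < I v) \<longrightarrow>
       (\<forall>u\<in>successors G w. u \<in> V1 \<and> I v \<le> I u) \<longrightarrow>
       LO_le (LO_seq (card (verts G) - 1) (card (verts G)) (image_mset I (mset_set (successors G w))))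
             (LO_seq (card (verts G) - 1) (card (verts G)) (image_mset I (mset_set (successors G v)))))"

lemma (in dag) greedy_indexing_round:
  assumes inv: "greedy_indexing G V1 I"
    and bij: "bij_betw I V1 {Suc s..<card (verts G)}"
    and s: "s < card (verts G)"
    and v: "v \<in> verts G - V1"
    and max: "\<And>w. w \<in> verts G - V1 \<Longrightarrow>
      LO_le (LO_seq (card (verts G) - 1) (card (verts G)) (temp_succ_indexes G s V1 I w))
            (LO_seq (card (verts G) - 1) (card (verts G)) (temp_succ_indexes G s V1 I v))"
  shows "greedy_indexing G (insert v V1) (I(v := s))"
proof -
  let ?J = "I(v := s)"
  let ?LO = "LO_seq (card (verts G) - 1) (card (verts G))"
  let ?key = "\<lambda>I w. ?LO (image_mset I (mset_set (successors G w)))"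
  have range: "s < I u \<and> I u < card (verts G)" if "u \<in> V1" for u
    using bij_betwE[OF bij] that by force
  have J: "?J u = I u" if "u \<in> V1" for u using v that by auto
  have succ_v: "successors G v \<subseteq> V1"
    using greedy_choice_successors_indexed[OF v s range max] by blast
  have succ_old: "u \<in> V1 \<and> I x < I u" if "x \<in> V1" "u \<in> successors G x" for x u
    using inv that unfolding greedy_indexing_def by blast
  have old_key: "?key ?J w = ?key I w" if "successors G w \<subseteq> V1" for w
  proof -
    have "image_mset ?J (mset_set (successors G w)) = image_mset I (mset_set (successors G w))"
      by (intro image_mset_cong J) (use that finite_successors[of w] in auto)
    then show ?thesis by simp
  qed
  have temp: "?LO (temp_succ_indexes G s V1 I w) = ?key ?J w"
    if "successors G w \<subseteq> insert v V1" for w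
    using that J by (subst temp_succ_indexes_final[where J = ?J]) auto
  have "u \<in> insert v V1 \<and> ?J x < ?J u" if "x \<in> insert v V1" "u \<in> successors G x" for x u
    using that succ_v succ_old[of x u] range J successors_subset[of G v] v by auto
  moreover have "LO_le (?key ?J w) (?key ?J x)"
    if x: "x \<in> insert v V1" and w: "w \<in> verts G" and later: "w \<in> insert v V1 \<longrightarrow> ?J w < ?J x"
      and succ: "\<forall>u\<in>successors G w. u \<in> insert v V1 \<and> ?J x \<le> ?J u" for x w
  proof (cases "x = v")
    case True
    have "w \<notin> V1" using later True range[of w] J[of w] by auto
    then have "LO_le (?LO (temp_succ_indexes G s V1 I w)) (?LO (temp_succ_indexes G s V1 I v))"
      using max w by blast
    moreover have "successors G w \<subseteq> insert v V1" using succ by blast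
    ultimately show ?thesis using True temp succ_v by (metis subset_insertI2)
  next
    case False
    then have x1: "x \<in> V1" using x by blast
    \<comment> \<open>\<open>v\<close> has a smaller index than \<open>x\<close>, so it cannot be a successor of \<open>w\<close>\<close>
    have succ1: "u \<in> V1 \<and> I x \<le> I u" if "u \<in> successors G w" for u
      using succ that range[OF x1] J[OF x1] J[of u] by (cases "u = v") auto
    have "w \<in> V1 \<longrightarrow> I w < I x" using later J[OF x1] J[of w] by auto
    then have "LO_le (?key I w) (?key I x)"
      using inv x1 w succ1 unfolding greedy_indexing_def by blast
    moreover have "successors G x \<subseteq> V1" using succ_old x1 by blast
    moreover have "successors G w \<subseteq> V1" using succ1 by blast
    ultimately show ?thesis using old_key by simp
  qed
  ultimately show ?thesis unfolding greedy_indexing_def by blast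
qed

lemma (in dag) algD_state_greedy_indexing:
  assumes "algD_state G r V1 I"
  shows "greedy_indexing G V1 I"
  using assms
proof (induction rule: algD_state.induct)
  case (init I)
  then show ?case by (simp add: greedy_indexing_def)
next
  case (round s V1 I n v)
  have "bij_betw I V1 {Suc s..<card (verts G)}" "s < card (verts G)"
    using algD_state_bij[OF round.hyps(1) finite_verts] by auto
  then show ?case using round by (intro greedy_indexing_round) auto
qed

lemma (in dag) algD_output_greedy_indexing:
  assumes "algD_output G I"
  shows "greedy_indexing G (verts G) I"
proof -
  obtain V1 where V1: "algD_state G 0 V1 I" using assms by (auto simp: algD_output_def)
  then have "V1 \<subseteq> verts G" "bij_betw I V1 {0..<card (verts G)}"
    using algD_state_bij[OF V1 finite_verts] by simp_all
  then have "V1 = verts G"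
    using bij_betw_same_card[of I V1] card_subset_eq[OF finite_verts] by simp
  then show ?thesis using algD_state_greedy_indexing[OF V1] by simp
qed

theorem theorem4:
  fixes G :: "('a, 'b) pre_digraph" and I :: "'a \<Rightarrow> nat" and n :: nat
  assumes "dag G"
    and "connected G"
    and "n = card (verts G)"
    and "n \<ge> 1"
    and "algD_output G I"
  shows "\<forall>v \<in> {..<n - 1}.
           LO_le (LO_seq (n - 1) n (mset_set (succ_indexes G I v)))
                 (LO_seq (n - 1) n (mset_set (succ_indexes G I (v + 1))))"
proof
  fix i assume i: "i \<in> {..<n - 1}"
  interpret dag G by fact
  have bij: "bij_betw I (verts G) {..<n}"
    using algD_output_bij[OF assms(5) finite_verts] assms(3) by simp
  have inj: "inj_on I (verts G)" using bij by (rule bij_betw_imp_inj_on)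
  have greedy: "greedy_indexing G (verts G) I"
    using assms(5) by (rule algD_output_greedy_indexing)
  have node: "inv_into (verts G) I j \<in> verts G" "I (inv_into (verts G) I j) = j" if "j < n" for j
    using bij that by (auto simp: bij_betw_def inv_into_into f_inv_into_f)
  have succ_indexes: "mset_set (succ_indexes G I j)
      = image_mset I (mset_set (successors G (inv_into (verts G) I j)))" for j
  proof -
    have "inj_on I (successors G (inv_into (verts G) I j))"
      by (rule inj_on_subset[OF inj]) (auto simp: successors_def)
    then show ?thesis by (simp add: succ_indexes_def image_mset_mset_set)
  qed
  let ?w = "inv_into (verts G) I i" and ?v = "inv_into (verts G) I (i + 1)"
  have w: "?w \<in> verts G" "I ?w = i" and v: "?v \<in> verts G" "I ?v = i + 1"
    using node[of i] node[of "i + 1"] i by auto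
  have "\<forall>u\<in>successors G ?w. u \<in> verts G \<and> I ?v \<le> I u"
    using greedy w v unfolding greedy_indexing_def by fastforce
  then show "LO_le (LO_seq (n - 1) n (mset_set (succ_indexes G I i)))
                   (LO_seq (n - 1) n (mset_set (succ_indexes G I (i + 1))))"
    using greedy w v unfolding succ_indexes greedy_indexing_def assms(3) by simp
qed

end
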